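(* Let $\lambda$ be a nonzero real number, let $Y$ be a real random variable whose moment generating function $E[e^{tY}]$ exists in a neighborhood of $t=0$, let $(Y_j)_{j\ge 1}$ be a sequence of mutually independent copies of $Y$, and let $S_0=0$, $S_k=Y_1+\cdots+Y_k$ for $k\ge 1$. Then for all integers $n,l\ge 0$ and all $y$, $$\phi_{l+n,\lambda}^{Y}(y)=\sum_{k=0}^{n}\sum_{m=0}^{l}\binom{l}{m}\frac{y^{k}}{k!}\sum_{l_{1}+\cdots+l_{k}=n}\binom{n}{l_{1},\dots,l_{k}}\,E\bigg[(S_{k}-n\lambda)_{l-m,\lambda}\prod_{i=1}^{k}(Y_{i})_{l_{i},\lambda}\bigg]\phi_{m,\lambda}^{Y}(y),$$ where the inner sum runs over all $k$-tuples $(l_1,\dots,l_k)$ of positive integers with $l_1+\cdots+l_k=n$, and $\phi^{Y}_{n,\lambda}$ denotes the probabilistic degenerate Bell polynomials associated with $Y$.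
   Context: For real $x$ and $\lambda$, the degenerate falling factorials are $(x)_{0,\lambda}=1$ and $(x)_{n,\lambda}=x(x-\lambda)(x-2\lambda)\cdots(x-(n-1)\lambda)$ for $n\ge 1$. The degenerate exponential is $e_{\lambda}^{x}(t)=\sum_{n=0}^{\infty}(x)_{n,\lambda}\frac{t^{n}}{n!}=(1+\lambda t)^{x/\lambda}$. Accordingly $E[e_\lambda^Y(t)]=\sum_{n\ge 0}E[(Y)_{n,\lambda}]\frac{t^n}{n!}$ (all moments of $Y$ are finite). The probabilistic degenerate Bell polynomials associated with $Y$, $\phi_{n,\lambda}^{Y}(x)$ ($n\ge 0$), are defined by the generating function $$e^{x\left(E[e_{\lambda}^{Y}(t)]-1\right)}=\sum_{n=0}^{\infty}\phi_{n,\lambda}^{Y}(x)\frac{t^{n}}{n!}.$$ $\binom{n}{l_1,\dots,l_k}=\frac{n!}{l_1!\cdots l_k!}$ is the multinomial coefficient. For $k=0$, the sum over $l_1+\cdots+l_k=n$ consists of the single empty tuple (with multinomial coefficient and product equal to $1$) if $n=0$, and is empty (equal to $0$) if $n\geq 1$. *)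

theory Defs
  imports "HOL-Probability.Probability" "HOL-Computational_Algebra.Formal_Power_Series"
begin

definition deg_ffact :: "real \<Rightarrow> real \<Rightarrow> nat \<Rightarrow> real" where
  "deg_ffact lam x n = (\<Prod>i<n. x - real i * lam)"

definition mgf_exists_near_0 :: "'a measure \<Rightarrow> ('a \<Rightarrow> real) \<Rightarrow> bool" where
  "mgf_exists_near_0 M Y \<longleftrightarrow>
     (\<exists>r>0. \<forall>t. \<bar>t\<bar> < r \<longrightarrow> integrable M (\<lambda>\<omega>. exp (t * Y \<omega>)))"

text \<open>
  The copies may live on a probability space \<open>N\<close> other than the space \<open>M\<close> of \<open>Y\<close>, since
  \<open>M\<close> itself need not carry independent copies of \<open>Y\<close>. The sequence is indexed from 1;
  \<open>X 0\<close> is unconstrained.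
\<close>

definition iid_copies ::
    "'a measure \<Rightarrow> ('a \<Rightarrow> real) \<Rightarrow> 'b measure \<Rightarrow> (nat \<Rightarrow> 'b \<Rightarrow> real) \<Rightarrow> bool" where
  "iid_copies M Y N X \<longleftrightarrow>
     prob_space.indep_vars N (\<lambda>_. borel) X {1..} \<and>
     (\<forall>j\<ge>1. distr N borel (X j) = distr M borel Y)"

text \<open>The formal power series in \<open>t\<close> of the expectation of the degenerate exponential
  \<open>(1 + lam * t) powr (Y / lam)\<close>.\<close>

definition expect_deg_exp :: "'a measure \<Rightarrow> ('a \<Rightarrow> real) \<Rightarrow> real \<Rightarrow> real fps" where
  "expect_deg_exp M Y lam = Abs_fps (\<lambda>n. (\<integral>\<omega>. deg_ffact lam (Y \<omega>) n \<partial>M) / fact n)"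

text \<open>
  Since \<open>fps_exp x\<close> is the series of \<open>exp (x * t)\<close>, substituting
  \<open>expect_deg_exp M Y lam - 1\<close> gives the generating function of the probabilistic degenerate
  Bell polynomials. The substituted series has constant term 0 when \<open>M\<close> is a probability space.
\<close>

definition prob_deg_Bell :: "'a measure \<Rightarrow> ('a \<Rightarrow> real) \<Rightarrow> real \<Rightarrow> nat \<Rightarrow> real \<Rightarrow> real" where
  "prob_deg_Bell M Y lam n x = fact n * fps_nth (fps_exp x oo (expect_deg_exp M Y lam - 1)) n"

lemma prob_deg_Bell_egf:
  "Abs_fps (\<lambda>n. prob_deg_Bell M Y lam n x / fact n) = fps_exp x oo (expect_deg_exp M Y lam - 1)"
  by (rule fps_ext) (simp add: prob_deg_Bell_def)

lemma (in prob_space) expect_deg_exp_nth_0: "fps_nth (expect_deg_exp M Y lam) 0 = 1"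
  by (simp add: expect_deg_exp_def deg_ffact_def prob_space)

text \<open>Tuples \<open>(l 1, \<dots>, l k)\<close> are functions on \<open>{1..k}\<close>, extensional so that each tuple is
  counted once; for \<open>k = 0\<close> there is exactly one, the empty tuple.\<close>

definition pos_tuples :: "nat \<Rightarrow> nat \<Rightarrow> (nat \<Rightarrow> nat) set" where
  "pos_tuples k n = {l \<in> {1..k} \<rightarrow>\<^sub>E {1..}. (\<Sum>i=1..k. l i) = n}"

definition multinom :: "nat \<Rightarrow> nat \<Rightarrow> (nat \<Rightarrow> nat) \<Rightarrow> real" where
  "multinom n k l = fact n / (\<Prod>i=1..k. fact (l i))"

lemma finite_pos_tuples: "finite (pos_tuples k n)"
proof (rule finite_subset)
  show "pos_tuples k n \<subseteq> {1..k} \<rightarrow>\<^sub>E {1..n}"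
  proof
    fix l assume "l \<in> pos_tuples k n"
    then have l: "l \<in> {1..k} \<rightarrow>\<^sub>E {1..}" and sum: "(\<Sum>i=1..k. l i) = n"
      unfolding pos_tuples_def by blast+
    have "l i \<in> {1..n}" if i: "i \<in> {1..k}" for i
    proof -
      have "l i \<le> (\<Sum>i=1..k. l i)"
        by (rule member_le_sum[OF i]) simp_all
      moreover have "l i \<in> {1..}"
        using l i by (rule PiE_mem)
      ultimately show ?thesis
        using sum by simp
    qed
    moreover have "l i = undefined" if "i \<notin> {1..k}" for i
      using l that by (rule PiE_arb)
    ultimately show "l \<in> {1..k} \<rightarrow>\<^sub>E {1..n}"
      by (rule PiE_I)
  qed
  show "finite ({1..k} \<rightarrow>\<^sub>E {1..n})"
    by (rule finite_PiE) simp_all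
qed

end

theory Submission imports Defs begin

text \<open>
  Write \<open>f t = exp (y * (h t - 1))\<close> with \<open>h t\<close> the expectation of \<open>(1 + lam * t) powr (Y / lam)\<close>.
  The left-hand side is, up to factorials, a coefficient of
  \<open>f (t + s) = f t * exp (y * (h (t + s) - h t))\<close>. Expanding the second factor in \<open>s\<close>, the terms
  with \<open>y ^ k\<close> are products of \<open>k\<close> derivatives of \<open>h\<close>. The derivative of order \<open>j\<close> of \<open>h\<close> is the
  expectation of \<open>deg_ffact lam Y j * (1 + lam * t) powr ((Y - j * lam) / lam)\<close>. By independence such
  a product becomes a single expectation, in which the exponents \<open>(Y i - l i * lam) / lam\<close> add up
  to \<open>(S k - n * lam) / lam\<close>.
\<close>

section \<open>Degenerate falling factorials\<close>

lemma deg_ffact_0 [simp]: "deg_ffact lam x 0 = 1"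
  by (simp add: deg_ffact_def)

lemma deg_ffact_Suc: "deg_ffact lam x (Suc n) = deg_ffact lam x n * (x - real n * lam)"
  by (simp add: deg_ffact_def)

lemma deg_ffact_plus:
  "deg_ffact lam x (m + n) = deg_ffact lam x m * deg_ffact lam (x - real m * lam) n"
  by (induction n) (simp_all add: deg_ffact_Suc algebra_simps)

text \<open>Pulling \<open>- lam\<close> out of every factor leaves a rising factorial, which makes
  the Vandermonde identity for \<open>pochhammer\<close> available.\<close>

lemma deg_ffact_pochhammer:
  assumes "lam \<noteq> 0"
  shows "deg_ffact lam x n = (- lam) ^ n * pochhammer (- x / lam) n"
  using assms by (induction n) (simp_all add: deg_ffact_Suc pochhammer_Suc field_simps)

lemma deg_ffact_zero_Suc [simp]: "deg_ffact lam 0 (Suc n) = 0"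
  by (induction n) (simp_all add: deg_ffact_Suc)

lemma measurable_deg_ffact [measurable]: "(\<lambda>x. deg_ffact lam x n) \<in> borel_measurable borel"
  unfolding deg_ffact_def by measurable

text \<open>The formal series of \<open>(1 + lam * t) powr (x / lam)\<close> for a fixed number
  \<open>x\<close>.\<close>

definition fps_deg_exp :: "real \<Rightarrow> real \<Rightarrow> real fps" where
  "fps_deg_exp lam x = Abs_fps (\<lambda>n. deg_ffact lam x n / fact n)"

lemma fps_deg_exp_nth [simp]: "fps_nth (fps_deg_exp lam x) n = deg_ffact lam x n / fact n"
  by (simp add: fps_deg_exp_def)

lemma fps_deg_exp_0 [simp]: "fps_deg_exp lam 0 = 1"
proof (rule fps_ext)
  fix n show "fps_nth (fps_deg_exp lam 0) n = fps_nth 1 n"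
    by (cases n) simp_all
qed

text \<open>The exponent law of the degenerate exponential; coefficientwise it is the Vandermonde
  identity.\<close>

lemma fps_deg_exp_add:
  assumes "lam \<noteq> 0"
  shows "fps_deg_exp lam (a + b) = fps_deg_exp lam a * fps_deg_exp lam b"
proof (rule fps_ext)
  fix n
  have "deg_ffact lam (a + b) n / fact n =
      (- lam) ^ n * pochhammer (- a / lam + - b / lam) n / fact n"
    using assms by (simp add: deg_ffact_pochhammer diff_divide_distrib)
  also have "\<dots> = (\<Sum>k\<le>n. (- lam) ^ n * (real (n choose k) * pochhammer (- a / lam) k *
      pochhammer (- b / lam) (n - k)) / fact n)"
    unfolding pochhammer_binomial_sum by (simp add: sum_distrib_left sum_divide_distrib)
  also have "\<dots> = (\<Sum>k\<le>n. (deg_ffact lam a k / fact k) * (deg_ffact lam b (n - k) / fact (n - k)))"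
  proof (rule sum.cong[OF refl])
    fix k assume "k \<in> {..n}"
    then have k: "k \<le> n" by simp
    have "(- lam) ^ n = (- lam) ^ k * (- lam) ^ (n - k)"
      using k by (simp flip: power_add)
    moreover have "real (n choose k) = fact n / (fact k * fact (n - k))"
      using k by (simp add: binomial_fact)
    ultimately show "(- lam) ^ n * (real (n choose k) * pochhammer (- a / lam) k *
        pochhammer (- b / lam) (n - k)) / fact n =
        (deg_ffact lam a k / fact k) * (deg_ffact lam b (n - k) / fact (n - k))"
      using assms by (simp add: deg_ffact_pochhammer)
  qed
  finally show "fps_nth (fps_deg_exp lam (a + b)) n =
      fps_nth (fps_deg_exp lam a * fps_deg_exp lam b) n"
    by (simp add: fps_mult_nth atMost_atLeast0)
qed

lemma fps_deg_exp_sum: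
  assumes "lam \<noteq> 0" and "finite A"
  shows "fps_deg_exp lam (\<Sum>i\<in>A. x i) = (\<Prod>i\<in>A. fps_deg_exp lam (x i))"
  using assms(2) by (induction A) (simp_all add: fps_deg_exp_add assms(1))

section \<open>Derivatives of exponential type series\<close>

lemma fps_nth_deriv_nth:
  fixes f :: "'a :: field_char_0 fps"
  shows "fps_nth (fps_nth_deriv n f) l = fact (l + n) / fact l * fps_nth f (l + n)"
  by (induction n arbitrary: f) (simp_all add: field_simps)

text \<open>For a series in \<open>s\<close> whose coefficients are series in \<open>t\<close>, this
  is the partial derivative in \<open>t\<close>, while \<open>fps_deriv\<close> is the one in
  \<open>s\<close>.\<close>

definition fps_coeff_deriv :: "'a :: comm_semiring_1 fps fps \<Rightarrow> 'a fps fps" where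
  "fps_coeff_deriv a = Abs_fps (\<lambda>n. fps_deriv (fps_nth a n))"

lemma fps_coeff_deriv_nth [simp]: "fps_nth (fps_coeff_deriv a) n = fps_deriv (fps_nth a n)"
  by (simp add: fps_coeff_deriv_def)

lemma fps_coeff_deriv_mult:
  fixes a b :: "'a :: comm_ring_1 fps fps"
  shows "fps_coeff_deriv (a * b) = a * fps_coeff_deriv b + fps_coeff_deriv a * b"
  by (rule fps_ext) (simp add: fps_mult_nth fps_deriv_sum sum.distrib)

lemma fps_coeff_deriv_power:
  fixes a :: "'a :: comm_ring_1 fps fps"
  shows "fps_coeff_deriv (a ^ Suc k) = of_nat (Suc k) * fps_coeff_deriv a * a ^ k"
proof (induction k)
  case (Suc k)
  have "fps_coeff_deriv (a ^ Suc (Suc k)) = a * fps_coeff_deriv (a ^ Suc k) + fps_coeff_deriv a * a ^ Suc k"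
    unfolding power_Suc[of a "Suc k"] by (rule fps_coeff_deriv_mult)
  then show ?case unfolding Suc by (simp add: algebra_simps)
qed simp

text \<open>The formal Taylor expansion of \<open>g (t + s) - g t\<close> in powers of \<open>s\<close>, with coefficients in
  power series in \<open>t\<close>.\<close>

definition fps_taylor_diff :: "'a :: field_char_0 fps \<Rightarrow> 'a fps fps" where
  "fps_taylor_diff g =
     Abs_fps (\<lambda>j. if j = 0 then 0 else fps_const (1 / fact j) * fps_nth_deriv j g)"

lemma fps_taylor_diff_nth:
  "fps_nth (fps_taylor_diff g) j =
     (if j = 0 then 0 else fps_const (1 / fact j) * fps_nth_deriv j g)"
  by (simp add: fps_taylor_diff_def)

text \<open>The derivatives of \<open>g (t + s)\<close> in \<open>s\<close> and in \<open>t\<close>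
  agree; the subtracted \<open>g t\<close> contributes only to the one in \<open>t\<close>, which
  leaves the extra summand.\<close>

lemma fps_deriv_taylor_diff:
  "fps_deriv (fps_taylor_diff g) = fps_const (fps_deriv g) + fps_coeff_deriv (fps_taylor_diff g)"
proof (rule fps_ext)
  fix n
  have "of_nat (Suc n) * (fps_const (1 / fact (Suc n)) * fps_nth_deriv (Suc n) g) =
      fps_const (of_nat (Suc n) * (1 / fact (Suc n))) * fps_nth_deriv (Suc n) g"
    by (simp only: fps_of_nat[symmetric] fps_const_mult[symmetric] mult.assoc)
  also have "of_nat (Suc n) * (1 / fact (Suc n)) = (1 / fact n :: 'a)"
    by (simp add: field_simps del: of_nat_Suc)
  finally have "of_nat (Suc n) * (fps_const (1 / fact (Suc n)) * fps_nth_deriv (Suc n) g) =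
      fps_const (1 / fact n) * fps_deriv (fps_nth_deriv n g)"
    by (simp only: fps_nth_deriv_commute)
  then show "fps_nth (fps_deriv (fps_taylor_diff g)) n =
      fps_nth (fps_const (fps_deriv g) + fps_coeff_deriv (fps_taylor_diff g)) n"
    by (auto simp: fps_taylor_diff_nth simp del: of_nat_Suc fact_Suc)
qed

text \<open>A form of Faa di Bruno's formula for \<open>f = exp g\<close>: it reads off the coefficient of \<open>s ^ n\<close> in
  \<open>f (t + s) = f t * exp (g (t + s) - g t)\<close>.\<close>

lemma fps_nth_deriv_exp_type:
  fixes f g :: "'a :: field_char_0 fps"
  assumes fg: "fps_deriv f = f * fps_deriv g"
  shows "fps_nth_deriv n f =
    f * (\<Sum>k\<le>n. fps_const (fact n / fact k) * fps_nth (fps_taylor_diff g ^ k) n)"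
proof -
  define u where "u = fps_taylor_diff g"
  \<comment> \<open>\<open>W k n\<close> is the partial Bell polynomial with indices
    \<open>n\<close> and \<open>k\<close> in the derivatives of \<open>g\<close>.\<close>
  define W where "W k n = fps_const (fact n / fact k) * fps_nth (u ^ k) n" for k n
  have u0: "fps_nth u 0 = 0"
    by (simp add: u_def fps_taylor_diff_nth)
  have W0: "W 0 (Suc n) = 0" for n
    by (simp add: W_def)
  have DW0: "fps_deriv (W 0 n) = 0" for n
    by (cases n) (simp_all add: W_def)
  \<comment> \<open>Since \<open>u\<close> has no constant term, \<open>u ^ k\<close> has no terms
    of degree below \<open>k\<close>.\<close>
  have Wgt: "W (Suc n) n = 0" for n
    using u0 startsby_zero_power_prefix[of u "Suc n"] by (simp add: W_def)
  \<comment> \<open>The recurrence comes from comparing coefficients of \<open>s ^ n\<close> in the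
    derivative of \<open>u ^ Suc k\<close> in \<open>s\<close>, which is rewritten through the
    derivative in \<open>t\<close>.\<close>
  have WSuc: "W (Suc k) (Suc n) = fps_deriv g * W k n + fps_deriv (W (Suc k) n)" for k n
  proof -
    have "fps_deriv (u ^ Suc k) = of_nat (Suc k) * fps_deriv u * u ^ k"
      using fps_deriv_power'[of u "Suc k"] by simp
    also have "\<dots> = of_nat (Suc k) * (fps_const (fps_deriv g) * u ^ k) + fps_coeff_deriv (u ^ Suc k)"
      unfolding fps_coeff_deriv_power u_def fps_deriv_taylor_diff by (simp add: algebra_simps)
    finally have "fps_nth (fps_deriv (u ^ Suc k)) n =
        fps_nth (of_nat (Suc k) * (fps_const (fps_deriv g) * u ^ k) + fps_coeff_deriv (u ^ Suc k)) n"
      by simp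
    then have eq: "of_nat (Suc n) * fps_nth (u ^ Suc k) (Suc n) =
        of_nat (Suc k) * (fps_deriv g * fps_nth (u ^ k) n) + fps_deriv (fps_nth (u ^ Suc k) n)"
      by (simp del: of_nat_Suc power_Suc fps_mult_left_const_nth
          add: fps_of_nat[symmetric] fps_mult_left_const_nth)
    have "W (Suc k) (Suc n) =
        fps_const (fact n / fact (Suc k)) * (of_nat (Suc n) * fps_nth (u ^ Suc k) (Suc n))"
      unfolding W_def fps_of_nat[symmetric] mult.assoc[symmetric] fps_const_mult
      by (simp add: mult_ac del: of_nat_Suc power_Suc)
    also have "\<dots> = fps_const (fact n / fact (Suc k)) * fps_const (of_nat (Suc k)) *
          (fps_deriv g * fps_nth (u ^ k) n) +
        fps_const (fact n / fact (Suc k)) * fps_deriv (fps_nth (u ^ Suc k) n)"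
      unfolding eq by (simp add: distrib_left mult.assoc fps_of_nat del: of_nat_Suc power_Suc)
    also have "fps_const (fact n / fact (Suc k)) * fps_const (of_nat (Suc k)) =
        fps_const (fact n / fact k :: 'a)"
      by (simp add: field_simps del: of_nat_Suc)
    finally show ?thesis
      by (simp add: W_def mult_ac del: power_Suc fact_Suc)
  qed
  have "fps_nth_deriv n f = f * (\<Sum>k\<le>n. W k n)"
  proof (induction n)
    case 0
    show ?case by (simp add: W_def)
  next
    case (Suc n)
    have "(\<Sum>k\<le>Suc n. W k (Suc n)) = (\<Sum>k\<le>n. W (Suc k) (Suc n))"
      by (simp add: sum.atMost_Suc_shift W0 del: sum.atMost_Suc)
    also have "\<dots> = fps_deriv g * (\<Sum>k\<le>n. W k n) + fps_deriv (\<Sum>k\<le>n. W (Suc k) n)"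
      by (simp add: WSuc sum.distrib sum_distrib_left fps_deriv_sum)
    \<comment> \<open>The added term \<open>W 0 n\<close> is constant in \<open>t\<close>; the top
      term \<open>W (Suc n) n\<close> is then dropped by \<open>Wgt\<close>.\<close>
    also have "fps_deriv (\<Sum>k\<le>n. W (Suc k) n) = fps_deriv (\<Sum>k\<le>Suc n. W k n)"
      by (simp add: sum.atMost_Suc_shift DW0 del: sum.atMost_Suc)
    also have "(\<Sum>k\<le>Suc n. W k n) = (\<Sum>k\<le>n. W k n)"
      by (simp add: Wgt)
    finally show ?case
      unfolding fps_nth_deriv_commute Suc by (simp add: fg algebra_simps)
  qed
  then show ?thesis by (simp add: W_def u_def)
qed

text \<open>Expanding the product, a tuple records the degree taken from each factor; a zero entry
  would contribute the vanishing constant term.\<close>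

lemma fps_power_nth_pos_tuples:
  fixes u :: "'a :: comm_ring_1 fps"
  assumes "fps_nth u 0 = 0"
  shows "fps_nth (u ^ k) n = (\<Sum>ls\<in>pos_tuples k n. \<Prod>i=1..k. fps_nth u (ls i))"
proof -
  let ?P = "{Z \<in> multisets_of_size {1..k} n. \<forall>i\<in>{1..k}. count Z i \<noteq> 0}"
  \<comment> \<open>The product formula is indexed by multisets, the multiplicity of
    \<open>i\<close> being the degree taken from factor \<open>i\<close>. \<open>?ms\<close> turns a
    tuple into such a multiset, with inverse \<open>count\<close> restricted to
    \<open>{1..k}\<close>.\<close>
  let ?ms = "\<lambda>ls :: nat \<Rightarrow> nat. \<Sum>i=1..k. replicate_mset (ls i) i"
  have count_ms: "count (?ms ls) i = (if i \<in> {1..k} then ls i else 0)" for ls i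
    by (simp add: count_sum if_distrib cong: if_cong)
  have size_eq: "size Z = (\<Sum>i=1..k. count Z i)" if "set_mset Z \<subseteq> {1..k}" for Z
    unfolding size_multiset_overloaded_eq
    by (rule sum.mono_neutral_left) (use that in \<open>auto simp: not_in_iff\<close>)
  have "fps_nth (u ^ k) n = fps_nth (\<Prod>i=1..k. u) n"
    by simp
  also have "\<dots> = (\<Sum>Z\<in>multisets_of_size {1..k} n. \<Prod>i=1..k. fps_nth u (count Z i))"
    by (rule fps_prod_nth') simp
  also have "\<dots> = (\<Sum>Z\<in>?P. \<Prod>i=1..k. fps_nth u (count Z i))"
  proof (rule sum.mono_neutral_right)
    show "\<forall>Z\<in>multisets_of_size {1..k} n - ?P. (\<Prod>i=1..k. fps_nth u (count Z i)) = 0"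
    proof
      fix Z assume "Z \<in> multisets_of_size {1..k} n - ?P"
      then obtain i where "i \<in> {1..k}" "count Z i = 0" by blast
      then show "(\<Prod>i=1..k. fps_nth u (count Z i)) = 0"
        using assms by (intro prod_zero) (auto intro!: bexI[of _ i])
    qed
  qed auto
  also have "\<dots> = (\<Sum>ls\<in>pos_tuples k n. \<Prod>i=1..k. fps_nth u (ls i))"
  proof (rule sum.reindex_bij_witness[of _ ?ms "\<lambda>Z. restrict (count Z) {1..k}"])
    fix Z assume Z: "Z \<in> ?P"
    then have sub: "set_mset Z \<subseteq> {1..k}" by (simp add: multisets_of_size_def)
    then show "?ms (restrict (count Z) {1..k}) = Z"
      by (intro multiset_eqI) (auto simp: count_ms not_in_iff simp del: One_nat_def)
    show "restrict (count Z) {1..k} \<in> pos_tuples k n"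
      using Z size_eq[OF sub] by (auto simp: pos_tuples_def multisets_of_size_def Suc_le_eq)
  next
    fix ls assume ls: "ls \<in> pos_tuples k n"
    have sub: "set_mset (?ms ls) \<subseteq> {1..k}"
    proof
      fix i assume "i \<in># ?ms ls"
      then have "count (?ms ls) i \<noteq> 0" by (simp only: count_eq_zero_iff not_not)
      then show "i \<in> {1..k}" unfolding count_ms by presburger
    qed
    show "restrict (count (?ms ls)) {1..k} = ls"
    proof
      fix i
      have "ls i = undefined" if "i \<notin> {1..k}"
        using ls that PiE_arb[of ls "{1..k}"] by (auto simp: pos_tuples_def)
      then show "restrict (count (?ms ls)) {1..k} i = ls i"
        by (simp add: restrict_def count_ms del: One_nat_def)
    qed
    show "?ms ls \<in> ?P"
    proof -
      have "size (?ms ls) = n"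
        unfolding size_eq[OF sub] using ls by (simp add: count_ms pos_tuples_def del: One_nat_def)
      moreover have "count (?ms ls) i \<noteq> 0" if "i \<in> {1..k}" for i
      proof -
        have "ls i \<noteq> 0"
          using ls that by (auto simp: pos_tuples_def dest!: PiE_mem)
        then show ?thesis
          using that unfolding count_ms by simp
      qed
      ultimately show ?thesis
        using sub by (simp add: multisets_of_size_def del: One_nat_def)
    qed
  qed auto
  finally show ?thesis .
qed

section \<open>Moments and independence\<close>

lemma power_le_fact_exp:
  fixes z :: real
  assumes "0 \<le> z"
  shows "z ^ n \<le> fact n * exp z"
proof -
  have "z ^ n / fact n = (\<Sum>i\<in>{n}. inverse (fact i) * z ^ i)"
    by (simp add: field_simps)
  also have "\<dots> \<le> (\<Sum>i. inverse (fact i) * z ^ i)"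
    by (rule sum_le_suminf[OF summable_exp]) (use assms in auto)
  also have "\<dots> = exp z"
    by (simp add: exp_def scaleR_conv_of_real)
  finally show ?thesis by (simp add: field_simps)
qed

lemma integrable_power_of_mgf:
  assumes "mgf_exists_near_0 M Y" and [measurable]: "Y \<in> borel_measurable M"
  shows "integrable M (\<lambda>\<omega>. Y \<omega> ^ n)"
proof -
  obtain r where r: "r > 0" "\<And>t. \<bar>t\<bar> < r \<Longrightarrow> integrable M (\<lambda>\<omega>. exp (t * Y \<omega>))"
    using assms(1) unfolding mgf_exists_near_0_def by blast
  \<comment> \<open>Both \<open>c\<close> and \<open>- c\<close> must lie strictly inside the
    interval where the moment generating function exists, as their exponentials together dominate
    \<open>exp (c * \<bar>Y \<omega>\<bar>)\<close>.\<close>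
  define c where "c = r / 2"
  have c: "c > 0" "\<bar>c\<bar> < r" "\<bar>- c\<bar> < r" using r(1) by (auto simp: c_def)
  have "integrable M (\<lambda>\<omega>. fact n / c ^ n * (exp (c * Y \<omega>) + exp (- c * Y \<omega>)))"
    by (intro integrable_mult_right Bochner_Integration.integrable_add r(2) c)
  then show ?thesis
  proof (rule Bochner_Integration.integrable_bound)
    show "AE \<omega> in M. norm (Y \<omega> ^ n) \<le> norm (fact n / c ^ n * (exp (c * Y \<omega>) + exp (- c * Y \<omega>)))"
    proof (rule AE_I2)
      fix \<omega>
      have "(c * \<bar>Y \<omega>\<bar>) ^ n \<le> fact n * exp (c * \<bar>Y \<omega>\<bar>)"
        using c by (intro power_le_fact_exp) simp
      also have "exp (c * \<bar>Y \<omega>\<bar>) \<le> exp (c * Y \<omega>) + exp (- c * Y \<omega>)"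
        by (cases "Y \<omega> \<ge> 0") auto
      finally have "c ^ n * \<bar>Y \<omega>\<bar> ^ n \<le> fact n * (exp (c * Y \<omega>) + exp (- c * Y \<omega>))"
        by (simp add: power_mult_distrib)
      then have "\<bar>Y \<omega>\<bar> ^ n \<le> fact n / c ^ n * (exp (c * Y \<omega>) + exp (- c * Y \<omega>))"
        using c(1) by (simp add: field_simps)
      then show "norm (Y \<omega> ^ n) \<le> norm (fact n / c ^ n * (exp (c * Y \<omega>) + exp (- c * Y \<omega>)))"
        using c(1) by (simp add: power_abs abs_mult)
    qed
  qed measurable
qed

text \<open>The power \<open>p\<close> is carried along because the new factor
  \<open>Y \<omega> - real n * lam\<close> raises it by one in one of the two resulting
  terms.\<close>

lemma integrable_power_mult_deg_ffact:
  assumes "\<And>n. integrable M (\<lambda>\<omega>. Y \<omega> ^ n)"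
  shows "integrable M (\<lambda>\<omega>. Y \<omega> ^ p * deg_ffact lam (Y \<omega>) n)"
proof (induction n arbitrary: p)
  case 0
  show ?case using assms by simp
next
  case (Suc n)
  have "integrable M (\<lambda>\<omega>. Y \<omega> ^ Suc p * deg_ffact lam (Y \<omega>) n -
      real n * lam * (Y \<omega> ^ p * deg_ffact lam (Y \<omega>) n))"
    by (intro Bochner_Integration.integrable_diff integrable_mult_right Suc)
  also have "(\<lambda>\<omega>. Y \<omega> ^ Suc p * deg_ffact lam (Y \<omega>) n -
      real n * lam * (Y \<omega> ^ p * deg_ffact lam (Y \<omega>) n)) =
      (\<lambda>\<omega>. Y \<omega> ^ p * deg_ffact lam (Y \<omega>) (Suc n))"
    by (simp add: deg_ffact_Suc algebra_simps)
  finally show ?case .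
qed

text \<open>A coefficient of the product is a finite sum of products of coefficients, one from each
  factor, and independence splits the expectation of each such product.\<close>

lemma (in prob_space) expectation_prod_fps_nth:
  fixes A :: "'i \<Rightarrow> real \<Rightarrow> real fps"
  assumes "finite I" and "indep_vars (\<lambda>_. borel) X I"
    and "\<And>i j. i \<in> I \<Longrightarrow> (\<lambda>x. fps_nth (A i x) j) \<in> borel_measurable borel"
    and "\<And>i j. i \<in> I \<Longrightarrow> integrable M (\<lambda>\<omega>. fps_nth (A i (X i \<omega>)) j)"
  shows "expectation (\<lambda>\<omega>. fps_nth (\<Prod>i\<in>I. A i (X i \<omega>)) n) =
    fps_nth (\<Prod>i\<in>I. Abs_fps (\<lambda>j. expectation (\<lambda>\<omega>. fps_nth (A i (X i \<omega>)) j))) n"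
proof -
  have indep: "indep_vars (\<lambda>_. borel) (\<lambda>i \<omega>. fps_nth (A i (X i \<omega>)) (v i)) I" for v :: "'i \<Rightarrow> nat"
    by (rule indep_vars_compose2[OF assms(2)]) (rule assms(3))
  have "expectation (\<lambda>\<omega>. fps_nth (\<Prod>i\<in>I. A i (X i \<omega>)) n) =
      expectation (\<lambda>\<omega>. \<Sum>Z\<in>multisets_of_size I n. \<Prod>i\<in>I. fps_nth (A i (X i \<omega>)) (count Z i))"
    by (simp add: fps_prod_nth' assms(1))
  also have "\<dots> = (\<Sum>Z\<in>multisets_of_size I n. expectation (\<lambda>\<omega>. \<Prod>i\<in>I. fps_nth (A i (X i \<omega>)) (count Z i)))"
    by (rule Bochner_Integration.integral_sum)
      (rule indep_vars_integrable[OF assms(1) indep assms(4)])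
  also have "\<dots> = (\<Sum>Z\<in>multisets_of_size I n. \<Prod>i\<in>I. expectation (\<lambda>\<omega>. fps_nth (A i (X i \<omega>)) (count Z i)))"
    by (intro sum.cong refl indep_vars_lebesgue_integral[OF assms(1) indep assms(4)])
  finally show ?thesis
    by (simp add: fps_prod_nth' assms(1))
qed

lemma fps_const_prod: "fps_const (\<Prod>i\<in>I. c i) = (\<Prod>i\<in>I. fps_const (c i))"
  by (induction I rule: infinite_finite_induct) (simp_all flip: fps_const_mult)

text \<open>Each factor on the right is \<open>deg_ffact lam (x i) (ls i)\<close> times the
  degenerate exponential of \<open>x i - real (ls i) * lam\<close>, so the exponents add up to the
  shifted sum. Being a product over \<open>i\<close>, this form is ready for independence.\<close>

lemma fps_deg_exp_shifted_prod:
  assumes "lam \<noteq> 0" and "finite I"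
  shows "deg_ffact lam ((\<Sum>i\<in>I. x i) - real (\<Sum>i\<in>I. ls i) * lam) p * (\<Prod>i\<in>I. deg_ffact lam (x i) (ls i)) =
    fact p * fps_nth (\<Prod>i\<in>I. Abs_fps (\<lambda>j. deg_ffact lam (x i) (ls i + j) / fact j)) p"
proof -
  have "Abs_fps (\<lambda>j. deg_ffact lam (x i) (ls i + j) / fact j) =
      fps_const (deg_ffact lam (x i) (ls i)) * fps_deg_exp lam (x i - real (ls i) * lam)" for i
    by (rule fps_ext) (simp add: deg_ffact_plus)
  then have "(\<Prod>i\<in>I. Abs_fps (\<lambda>j. deg_ffact lam (x i) (ls i + j) / fact j)) =
      fps_const (\<Prod>i\<in>I. deg_ffact lam (x i) (ls i)) *
      fps_deg_exp lam (\<Sum>i\<in>I. x i - real (ls i) * lam)"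
    using assms by (simp add: prod.distrib fps_deg_exp_sum fps_const_prod)
  then show ?thesis
    by (simp add: sum_subtractf sum_distrib_right)
qed

text \<open>Differentiating an exponential generating function shifts its coefficient sequence; the
  result is the expectation of one factor in \<open>fps_deg_exp_shifted_prod\<close>.\<close>

lemma fps_nth_deriv_expect_deg_exp:
  "fps_nth_deriv m (expect_deg_exp M Y lam) =
    Abs_fps (\<lambda>j. (\<integral>\<omega>. deg_ffact lam (Y \<omega>) (m + j) \<partial>M) / fact j)"
  by (rule fps_ext) (simp add: fps_nth_deriv_nth expect_deg_exp_def add.commute)

theorem theorem2p1:
  fixes M :: "'a measure" and N :: "'b measure"
    and Y :: "'a \<Rightarrow> real" and X :: "nat \<Rightarrow> 'b \<Rightarrow> real"
    and lam y :: real and n l :: nat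
  assumes "lam \<noteq> 0"
    and "prob_space M" and "Y \<in> borel_measurable M"
    and "mgf_exists_near_0 M Y"
    and "prob_space N" and "iid_copies M Y N X"
  defines "S \<equiv> \<lambda>k \<omega>. \<Sum>j=1..k. X j \<omega>"
  shows "prob_deg_Bell M Y lam (l + n) y =
    (\<Sum>k=0..n. \<Sum>m=0..l. real (l choose m) * (y ^ k / fact k) *
       (\<Sum>ls\<in>pos_tuples k n. multinom n k ls *
          (\<integral>\<omega>. deg_ffact lam (S k \<omega> - real n * lam) (l - m) *
               (\<Prod>i=1..k. deg_ffact lam (X i \<omega>) (ls i)) \<partial>N)) *
       prob_deg_Bell M Y lam m y)"
proof -
  interpret M: prob_space M by fact
  interpret N: prob_space N by fact
  note [measurable] = assms(3)
  define h where "h = expect_deg_exp M Y lam"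
  define f where "f = fps_exp y oo (h - 1)"
  \<comment> \<open>The true exponent is \<open>y * (h - 1)\<close>; the constant \<open>- y\<close>
    affects neither the derivative nor the Taylor difference.\<close>
  define g where "g = fps_const y * h"
  define T where "T k p = (\<Sum>ls\<in>pos_tuples k n. multinom n k ls *
      (\<integral>\<omega>. deg_ffact lam (S k \<omega> - real n * lam) p *
        (\<Prod>i=1..k. deg_ffact lam (X i \<omega>) (ls i)) \<partial>N))" for k p

  have indep: "N.indep_vars (\<lambda>_. borel) X {1..}"
    and distr: "\<And>j. j \<ge> 1 \<Longrightarrow> distr N borel (X j) = distr M borel Y"
    using assms(6) by (auto simp: iid_copies_def)
  have meas: "X j \<in> borel_measurable N" if "j \<ge> 1" for j
    using indep that by (auto simp: N.indep_vars_def)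
  have int_Y: "integrable M (\<lambda>\<omega>. deg_ffact lam (Y \<omega>) j)" for j
    using integrable_power_mult_deg_ffact[of M Y 0, OF integrable_power_of_mgf[OF assms(4,3)]]
    by simp
  have int_X: "integrable N (\<lambda>\<omega>. deg_ffact lam (X i \<omega>) j)" if "i \<ge> 1" for i j
  proof -
    have "integrable (distr M borel Y) (\<lambda>x. deg_ffact lam x j)"
      by (subst integrable_distr_eq) (simp_all add: int_Y)
    then show ?thesis
      unfolding distr[OF that, symmetric]
      by (subst (asm) integrable_distr_eq) (use meas[OF that] in simp_all)
  qed
  have E_X: "(\<integral>\<omega>. deg_ffact lam (X i \<omega>) j \<partial>N) = (\<integral>\<omega>. deg_ffact lam (Y \<omega>) j \<partial>M)" if "i \<ge> 1" for i j
  proof -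
    have "(\<integral>\<omega>. deg_ffact lam (X i \<omega>) j \<partial>N) = (\<integral>x. deg_ffact lam x j \<partial>distr N borel (X i))"
      by (rule integral_distr[symmetric]) (use meas[OF that] in simp_all)
    also have "\<dots> = (\<integral>\<omega>. deg_ffact lam (Y \<omega>) j \<partial>M)"
      unfolding distr[OF that] by (simp add: integral_distr)
    finally show ?thesis .
  qed

  \<comment> \<open>This is where probability enters: products of derivatives of \<open>h\<close>
    become single expectations over \<open>N\<close>.\<close>
  have prod_nth: "fps_nth (\<Prod>i=1..k. fps_nth_deriv (ls i) h) p =
      (\<integral>\<omega>. deg_ffact lam (S k \<omega> - real n * lam) p *
        (\<Prod>i=1..k. deg_ffact lam (X i \<omega>) (ls i)) \<partial>N) / fact p"
    if ls: "ls \<in> pos_tuples k n" for k p ls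
  proof -
    define A where "A i x = Abs_fps (\<lambda>j. deg_ffact lam x (ls i + j) / fact j)" for i x
    have n: "n = (\<Sum>i=1..k. ls i)"
      using ls by (simp add: pos_tuples_def)
    have "(\<integral>\<omega>. deg_ffact lam (S k \<omega> - real n * lam) p *
        (\<Prod>i=1..k. deg_ffact lam (X i \<omega>) (ls i)) \<partial>N) =
        fact p * (\<integral>\<omega>. fps_nth (\<Prod>i=1..k. A i (X i \<omega>)) p \<partial>N)"
      unfolding S_def n fps_deg_exp_shifted_prod[OF assms(1) finite_atLeastAtMost] A_def by simp
    also have "(\<integral>\<omega>. fps_nth (\<Prod>i=1..k. A i (X i \<omega>)) p \<partial>N) =
        fps_nth (\<Prod>i=1..k. Abs_fps (\<lambda>j. \<integral>\<omega>. fps_nth (A i (X i \<omega>)) j \<partial>N)) p"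
    proof (rule N.expectation_prod_fps_nth)
      show "N.indep_vars (\<lambda>_. borel) X {1..k}"
        by (rule N.indep_vars_subset[OF indep]) auto
    qed (auto simp: A_def int_X)
    also have "(\<Prod>i=1..k. Abs_fps (\<lambda>j. \<integral>\<omega>. fps_nth (A i (X i \<omega>)) j \<partial>N)) =
        (\<Prod>i=1..k. fps_nth_deriv (ls i) h)"
      by (intro prod.cong refl) (simp add: A_def h_def fps_nth_deriv_expect_deg_exp E_X)
    finally show ?thesis by simp
  qed

  have u_pow: "fps_nth (fps_taylor_diff g ^ k) n =
      fps_const (y ^ k / fact n) * (\<Sum>ls\<in>pos_tuples k n.
        fps_const (multinom n k ls) * (\<Prod>i=1..k. fps_nth_deriv (ls i) h))" for k
  proof -
    have "fps_nth (fps_taylor_diff g ^ k) n =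
        (\<Sum>ls\<in>pos_tuples k n. \<Prod>i=1..k. fps_nth (fps_taylor_diff g) (ls i))"
      by (rule fps_power_nth_pos_tuples) (simp add: fps_taylor_diff_nth)
    also have "\<dots> = (\<Sum>ls\<in>pos_tuples k n. fps_const (y ^ k / fact n) *
        (fps_const (multinom n k ls) * (\<Prod>i=1..k. fps_nth_deriv (ls i) h)))"
    proof (rule sum.cong[OF refl])
      fix ls assume ls: "ls \<in> pos_tuples k n"
      have "(\<Prod>i=1..k. fps_nth (fps_taylor_diff g) (ls i)) =
          (\<Prod>i=1..k. fps_const (y / fact (ls i)) * fps_nth_deriv (ls i) h)"
      proof (rule prod.cong[OF refl])
        \<comment> \<open>Positivity of the entries avoids the zero constant term of
          \<open>fps_taylor_diff\<close>, so each factor supplies one \<open>y\<close> and one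
          inverse factorial.\<close>
        fix i assume "i \<in> {1..k}"
        then have "ls i \<noteq> 0"
          using ls by (auto simp: pos_tuples_def dest!: PiE_mem)
        then show "fps_nth (fps_taylor_diff g) (ls i) =
            fps_const (y / fact (ls i)) * fps_nth_deriv (ls i) h"
          by (simp add: fps_taylor_diff_nth g_def mult.assoc[symmetric])
      qed
      also have "\<dots> = fps_const (\<Prod>i=1..k. y / fact (ls i)) * (\<Prod>i=1..k. fps_nth_deriv (ls i) h)"
        by (simp add: prod.distrib fps_const_prod)
      also have "(\<Prod>i=1..k. y / fact (ls i)) = y ^ k / fact n * multinom n k ls"
        by (simp add: prod_dividef multinom_def)
      finally show "(\<Prod>i=1..k. fps_nth (fps_taylor_diff g) (ls i)) = fps_const (y ^ k / fact n) *
          (fps_const (multinom n k ls) * (\<Prod>i=1..k. fps_nth_deriv (ls i) h))"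
        by (simp add: mult.assoc[symmetric])
    qed
    finally show ?thesis by (simp add: sum_distrib_left)
  qed

  \<comment> \<open>The chain and product rules for formal composition require a zero constant
    term.\<close>
  have "fps_nth (h - 1) 0 = 0"
    by (simp add: h_def M.expect_deg_exp_nth_0)
  then have "fps_deriv f = f * fps_deriv g"
    by (simp add: f_def g_def fps_compose_deriv fps_compose_mult_distrib mult_ac)
  from fps_nth_deriv_exp_type[OF this, of n]
  have Df: "fps_nth_deriv n f =
      f * (\<Sum>k\<le>n. fps_const (fact n / fact k) * fps_nth (fps_taylor_diff g ^ k) n)" .
  \<comment> \<open>Here \<open>fact n\<close> cancels the \<open>1 / fact n\<close> in
    \<open>u_pow\<close>.\<close>
  have coeff: "fps_nth (fps_const (fact n / fact k) * fps_nth (fps_taylor_diff g ^ k) n) p =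
      y ^ k / fact k * (T k p / fact p)" for k p
  proof -
    have "T k p / fact p = (\<Sum>ls\<in>pos_tuples k n.
        multinom n k ls * fps_nth (\<Prod>i=1..k. fps_nth_deriv (ls i) h) p)"
      unfolding T_def sum_divide_distrib by (intro sum.cong refl) (simp only: prod_nth times_divide_eq_right)
    then show ?thesis
      unfolding u_pow by (simp add: fps_sum_nth)
  qed

  have "prob_deg_Bell M Y lam (l + n) y = fact l * fps_nth (fps_nth_deriv n f) l"
    by (simp add: prob_deg_Bell_def fps_nth_deriv_nth f_def h_def)
  also have "\<dots> = fact l * (\<Sum>m=0..l. fps_nth f m * (\<Sum>k\<le>n. y ^ k / fact k * (T k (l - m) / fact (l - m))))"
    unfolding Df fps_mult_nth[of f] fps_sum_nth coeff ..
  also have "\<dots> = (\<Sum>m=0..l. \<Sum>k=0..n. fact l * (fps_nth f m * (y ^ k / fact k * (T k (l - m) / fact (l - m)))))"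
    by (simp only: sum_distrib_left atMost_atLeast0)
  also have "\<dots> = (\<Sum>m=0..l. \<Sum>k=0..n. real (l choose m) * (y ^ k / fact k) * T k (l - m) *
      prob_deg_Bell M Y lam m y)"
    \<comment> \<open>The binomial coefficient arises from \<open>fact l\<close>, the
      \<open>fact (l - m)\<close> below \<open>T\<close>, and the \<open>fact m\<close> in the
      definition of \<open>prob_deg_Bell\<close>.\<close>
    by (intro sum.cong refl)
      (simp add: binomial_fact prob_deg_Bell_def f_def h_def mult_ac)
  also have "\<dots> = (\<Sum>k=0..n. \<Sum>m=0..l. real (l choose m) * (y ^ k / fact k) * T k (l - m) *
      prob_deg_Bell M Y lam m y)"
    by (rule sum.swap)
  finally show ?thesis
    by (simp only: T_def)
qed

end
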